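(* Let $A$ be a compactly generated locally compact abelian group and let $M$ be an LC $A$-module. Then the polycompact radical $\mathrm{W}(M)$ is a closed subgroup of $M$, and every compact subset of $\mathrm{W}(M)$ is contained in a compact submodule of $M$.
   Context: All topological groups are Hausdorff. For a locally compact abelian (LCA) group $A$, an LC $A$-module is an LCA group $M$ together with a continuous action $A\times M\to M$ of $A$ by topological group automorphisms; submodules are $A$-invariant subgroups. The polycompact radical $\mathrm{W}(M)$ is the sum (union, i.e. the subgroup generated) of all compact submodules of $M$. *)

theory Defs
  imports "HOL-Analysis.Analysis"
begin

text \<open>Topological abelian groups are modelled by the type class
  topological_ab_group_add together with t2_space (Hausdorff);
  the whole type is the group.\<close>

definition add_subgroup :: "'g::ab_group_add set \<Rightarrow> bool" where
  "add_subgroup H \<longleftrightarrow> 0 \<in> H \<and> (\<forall>x\<in>H. \<forall>y\<in>H. x + y \<in> H) \<and> (\<forall>x\<in>H. - x \<in> H)"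

definition subgroup_generated :: "'g::ab_group_add set \<Rightarrow> 'g set" where
  "subgroup_generated S = \<Inter>{H. add_subgroup H \<and> S \<subseteq> H}"

definition compactly_generated_group :: "'g::{ab_group_add,topological_space} itself \<Rightarrow> bool" where
  "compactly_generated_group _ \<longleftrightarrow> (\<exists>K::'g set. compact K \<and> subgroup_generated K = UNIV)"

definition LCA_group :: "'g::{topological_ab_group_add,t2_space} itself \<Rightarrow> bool" where
  "LCA_group _ \<longleftrightarrow> locally_compact_space (euclidean :: 'g topology)"

text \<open>A continuous action of A on M by group automorphisms (written additively on A).
  Each map act a is additive; together with the action axioms it is bijective with inverse
  act (-a), and continuity of the joint action makes each act a a homeomorphism.\<close>
definition LC_module ::
  "('a::{topological_ab_group_add,t2_space} \<Rightarrow> 'm::{topological_ab_group_add,t2_space} \<Rightarrow> 'm) \<Rightarrow> bool" where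
  "LC_module act \<longleftrightarrow>
     LCA_group TYPE('a) \<and> LCA_group TYPE('m) \<and>
     (\<forall>m. act 0 m = m) \<and>
     (\<forall>a b m. act (a + b) m = act a (act b m)) \<and>
     (\<forall>a x y. act a (x + y) = act a x + act a y) \<and>
     (\<forall>a. bij (act a) \<and> continuous_on UNIV (act a) \<and> continuous_on UNIV (inv (act a))) \<and>
     continuous_on UNIV (\<lambda>(a, m). act a m)"

definition submodule :: "('a \<Rightarrow> 'm::ab_group_add \<Rightarrow> 'm) \<Rightarrow> 'm set \<Rightarrow> bool" where
  "submodule act N \<longleftrightarrow> add_subgroup N \<and> (\<forall>a. \<forall>x\<in>N. act a x \<in> N)"

definition polycompact_radical ::
  "('a \<Rightarrow> 'm::{ab_group_add,topological_space} \<Rightarrow> 'm) \<Rightarrow> 'm set" where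
  "polycompact_radical act = subgroup_generated (\<Union>{N. submodule act N \<and> compact N})"

end

theory Submission
  imports Defs
begin

text \<open>Let S generate A and let V be a compact symmetric neighbourhood of 0 in the closure of
  W(M). As W(M) is dense there and a directed union of compact submodules, the compact set
  S V \<union> (V + V) lies in L + V for some compact submodule L. But then L + V is itself
  stable under S, addition and negation, so it is a compact submodule which contains V. Hence
  W(M) is open in its closure, therefore closed, and a compact subset of W(M) is covered by
  finitely many translates of L + V.\<close>

section \<open>Closures of subgroups and of submodules\<close>

lemma add_subgroup_closure:
  fixes H :: "'g::topological_ab_group_add set"
  assumes "add_subgroup H"
  shows "add_subgroup (closure H)"
proof -
  have H: "0 \<in> H" "\<And>x y. x \<in> H \<Longrightarrow> y \<in> H \<Longrightarrow> x + y \<in> H" "\<And>x. x \<in> H \<Longrightarrow> - x \<in> H"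
    using assms by (auto simp: add_subgroup_def)
  have "(\<lambda>(x, y). x + y) ` closure (H \<times> H) \<subseteq> closure H"
    by (rule image_closure_subset)
      (auto simp: case_prod_unfold intro!: continuous_intros H(2) closure_subset[THEN subsetD])
  then have "x + y \<in> closure H" if "x \<in> closure H" "y \<in> closure H" for x y
    using that by (auto simp: closure_Times)
  moreover have "uminus ` closure H \<subseteq> closure H"
    by (rule image_closure_subset)
      (auto intro!: continuous_intros H(3) closure_subset[THEN subsetD])
  ultimately show ?thesis
    using H(1) closure_subset[of H] by (auto simp: add_subgroup_def)
qed

lemma submodule_closure:
  fixes act :: "'a \<Rightarrow> 'm::topological_ab_group_add \<Rightarrow> 'm"
  assumes "submodule act N" and "\<And>a. continuous_on UNIV (act a)"
  shows "submodule act (closure N)"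
proof -
  have "act a ` closure N \<subseteq> closure N" for a
  proof (rule image_closure_subset)
    show "continuous_on (closure N) (act a)"
      using assms(2) continuous_on_subset by blast
    show "act a ` N \<subseteq> closure N"
      using assms(1) closure_subset by (fastforce simp: submodule_def)
  qed auto
  then show ?thesis
    using assms(1) add_subgroup_closure by (auto simp: submodule_def)
qed

section \<open>Sums of compact submodules, and the radical as a directed union\<close>

lemma compact_plus:
  fixes A B :: "'g::topological_ab_group_add set"
  assumes "compact A" "compact B"
  shows "compact ((\<lambda>(x, y). x + y) ` (A \<times> B))"
  using assms
  by (intro compact_continuous_image compact_Times)
    (auto simp: case_prod_unfold intro!: continuous_intros)

lemma submodule_plus:
  fixes act :: "'a \<Rightarrow> 'm::ab_group_add \<Rightarrow> 'm"
  assumes "\<And>a x y. act a (x + y) = act a x + act a y"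
    and "submodule act L" "submodule act N"
  shows "submodule act ((\<lambda>(x, y). x + y) ` (L \<times> N))"
proof -
  have L: "0 \<in> L" "\<And>x y. x \<in> L \<Longrightarrow> y \<in> L \<Longrightarrow> x + y \<in> L" "\<And>x. x \<in> L \<Longrightarrow> - x \<in> L"
      "\<And>a x. x \<in> L \<Longrightarrow> act a x \<in> L"
    and N: "0 \<in> N" "\<And>x y. x \<in> N \<Longrightarrow> y \<in> N \<Longrightarrow> x + y \<in> N" "\<And>x. x \<in> N \<Longrightarrow> - x \<in> N"
      "\<And>a x. x \<in> N \<Longrightarrow> act a x \<in> N"
    using assms(2,3) by (auto simp: submodule_def add_subgroup_def)
  have "x + y + (x' + y') \<in> (\<lambda>(x, y). x + y) ` (L \<times> N)"
    if "x \<in> L" "x' \<in> L" "y \<in> N" "y' \<in> N" for x y x' y'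
    using that L(2) N(2) by (intro image_eqI[of _ _ "(x + x', y + y')"]) auto
  moreover have "- (x + y) \<in> (\<lambda>(x, y). x + y) ` (L \<times> N)" if "x \<in> L" "y \<in> N" for x y
    using that L(3) N(3) by (intro image_eqI[of _ _ "(- x, - y)"]) auto
  moreover have "act a (x + y) \<in> (\<lambda>(x, y). x + y) ` (L \<times> N)" if "x \<in> L" "y \<in> N" for a x y
    using that L(4) N(4) assms(1) by (intro image_eqI[of _ _ "(act a x, act a y)"]) auto
  moreover have "0 \<in> (\<lambda>(x, y). x + y) ` (L \<times> N)"
    using L(1) N(1) by (intro image_eqI[of _ _ "(0, 0)"]) auto
  ultimately show ?thesis
    by (auto simp: submodule_def add_subgroup_def)
qed

text \<open>Compact submodules form a directed family, since the sum of two of them is again one.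
  Their union is therefore already a subgroup, and generating adds nothing.\<close>

lemma polycompact_radical_eq_Union:
  fixes act :: "'a \<Rightarrow> 'm::topological_ab_group_add \<Rightarrow> 'm"
  assumes add: "\<And>a x y. act a (x + y) = act a x + act a y"
  shows "polycompact_radical act = \<Union>{N. submodule act N \<and> compact N}" (is "_ = ?U")
proof
  have "add_subgroup ?U"
    unfolding add_subgroup_def
  proof (intro conjI ballI)
    have "act a 0 = 0" for a
      using add[of a 0 0] by simp
    then have "submodule act {0}"
      by (simp add: submodule_def add_subgroup_def)
    then show "0 \<in> ?U"
      by (intro UnionI[of "{0}"]) auto
  next
    fix x y assume "x \<in> ?U" "y \<in> ?U"
    then obtain L N where "submodule act L" "compact L" "submodule act N" "compact N"
      "x \<in> L" "y \<in> N" by auto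
    then show "x + y \<in> ?U"
      by (intro UnionI[of "(\<lambda>(x, y). x + y) ` (L \<times> N)"])
        (auto intro: submodule_plus compact_plus add)
  qed (auto simp: submodule_def add_subgroup_def)
  then show "polycompact_radical act \<subseteq> ?U"
    by (auto simp: polycompact_radical_def subgroup_generated_def)
qed (auto simp: polycompact_radical_def subgroup_generated_def)

text \<open>Directedness again: one summand is added for each element of \<open>F\<close>. This is
  what lets a single compact \<open>L\<close> absorb the finitely many centres of a
  covering.\<close>

lemma finite_subset_polycompact_radical:
  fixes act :: "'a \<Rightarrow> 'm::topological_ab_group_add \<Rightarrow> 'm"
  assumes add: "\<And>a x y. act a (x + y) = act a x + act a y"
    and "finite F" "F \<subseteq> polycompact_radical act"
  obtains L where "submodule act L" "compact L" "F \<subseteq> L"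
proof -
  have "\<exists>L. submodule act L \<and> compact L \<and> F \<subseteq> L"
    using assms(2,3)
  proof (induction F)
    case empty
    \<comment> \<open>Even for the empty set some compact submodule has to be named; one that
      contains 0 is at hand.\<close>
    have "0 \<in> polycompact_radical act"
      by (auto simp: polycompact_radical_def subgroup_generated_def add_subgroup_def)
    then show ?case
      by (auto simp: polycompact_radical_eq_Union[of act, OF add])
  next
    case (insert x F)
    then obtain L N where LN: "submodule act L" "compact L" "F \<subseteq> L"
        "submodule act N" "compact N" "x \<in> N"
      by (auto simp: polycompact_radical_eq_Union[of act, OF add])
    then have "0 \<in> L" "0 \<in> N"
      by (auto simp: submodule_def add_subgroup_def)
    then have "insert x F \<subseteq> (\<lambda>(x, y). x + y) ` (L \<times> N)"
      using LN(3,6) by force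
    then show ?case
      using LN submodule_plus[of act L N, OF add] compact_plus[of L N] by blast
  qed
  then show ?thesis using that by blast
qed

lemma submodule_polycompact_radical:
  fixes act :: "'a \<Rightarrow> 'm::topological_ab_group_add \<Rightarrow> 'm"
  assumes add: "\<And>a x y. act a (x + y) = act a x + act a y"
  shows "submodule act (polycompact_radical act)"
proof -
  have "add_subgroup (polycompact_radical act)"
    by (auto simp: polycompact_radical_def subgroup_generated_def add_subgroup_def)
  moreover have "act a x \<in> polycompact_radical act" if "x \<in> polycompact_radical act" for a x
    using that by (auto simp: polycompact_radical_eq_Union[of act, OF add] submodule_def)
  ultimately show ?thesis
    by (simp add: submodule_def)
qed

section \<open>Compact neighbourhoods of 0 and coverings by translates\<close>

lemma compact_symmetric_neighbourhood:
  assumes "LCA_group TYPE('g::{topological_ab_group_add,t2_space})"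
  obtains U V :: "'g::{topological_ab_group_add,t2_space} set" where "open U" "compact V" "0 \<in> U" "U \<subseteq> V" "uminus ` V \<subseteq> V"
proof -
  obtain U0 V0 :: "'g set" where *: "open U0" "compact V0" "0 \<in> U0" "U0 \<subseteq> V0"
    using assms unfolding LCA_group_def locally_compact_space_def
    by simp (metis (no_types))
  have "open (uminus -` U0)"
    using * by (intro open_vimage continuous_intros)
  moreover have "compact (V0 \<inter> uminus -` V0)"
    using * by (intro compact_Int_closed closed_vimage continuous_intros compact_imp_closed)
  ultimately show ?thesis
    using * by (intro that[of "U0 \<inter> uminus -` U0" "V0 \<inter> uminus -` V0"]) auto
qed

text \<open>Density lets the centres be chosen in \<open>W\<close> itself although \<open>K\<close>
  lies only in its closure. The differences stay in the closure because that is a subgroup.\<close>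

lemma compact_subset_closure_finite_translates:
  fixes W U K :: "'g::topological_ab_group_add set"
  assumes "add_subgroup W" "open U" "0 \<in> U" "compact K" "K \<subseteq> closure W"
  obtains F where "finite F" "F \<subseteq> W"
    "\<And>x. x \<in> K \<Longrightarrow> \<exists>w\<in>F. x - w \<in> U \<inter> closure W"
proof -
  let ?T = "\<lambda>w. (\<lambda>x. x - w) -` U"
  have "open (?T w)" for w
    using assms(2) by (intro open_vimage continuous_intros)
  moreover have "K \<subseteq> (\<Union>w\<in>W. ?T w)"
  proof
    fix x assume "x \<in> K"
    \<comment> \<open>This set is \<open>x - U\<close>, an open neighbourhood of \<open>x\<close>
      because 0 lies in \<open>U\<close>; hence it meets \<open>W\<close>.\<close>
    have "open ((\<lambda>w. x - w) -` U)"
      using assms(2) by (intro open_vimage continuous_intros)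
    moreover have "x \<in> (\<lambda>w. x - w) -` U \<inter> closure W"
      using \<open>x \<in> K\<close> assms by auto
    ultimately have "(\<lambda>w. x - w) -` U \<inter> W \<noteq> {}"
      by (metis open_Int_closure_eq_empty empty_iff)
    then show "x \<in> (\<Union>w\<in>W. ?T w)" by auto
  qed
  ultimately obtain F where F: "F \<subseteq> W" "finite F" "K \<subseteq> (\<Union>w\<in>F. ?T w)"
    using compactE_image[OF assms(4), of W ?T] by metis
  have "x - w \<in> closure W" if "x \<in> K" "w \<in> F" for x w
  proof -
    have "x \<in> closure W" "- w \<in> closure W"
      using that assms F closure_subset[of W] by (auto simp: add_subgroup_def)
    then have "x + - w \<in> closure W"
      using add_subgroup_closure[OF assms(1)] unfolding add_subgroup_def by blast
    then show ?thesis by simp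
  qed
  then show ?thesis
    using F by (intro that[of F]) blast+
qed

section \<open>Compact submodules from compact generation\<close>

lemma submodule_if_generators:
  fixes act :: "'a::ab_group_add \<Rightarrow> 'm::ab_group_add \<Rightarrow> 'm"
  assumes "subgroup_generated S = UNIV"
    and "\<And>m. act 0 m = m" "\<And>a b m. act (a + b) m = act a (act b m)"
    and "add_subgroup N"
    and "\<And>a x. a \<in> S \<Longrightarrow> x \<in> N \<Longrightarrow> act a x \<in> N \<and> act (- a) x \<in> N"
  shows "submodule act N"
proof -
  \<comment> \<open>Both signs are required, because \<open>act a\<close> may map \<open>N\<close>
    properly into itself; with \<open>a\<close> alone only a submonoid would result.\<close>
  let ?H = "{a. \<forall>x\<in>N. act a x \<in> N \<and> act (- a) x \<in> N}"
  have "act (- (a + b)) x \<in> N" if "a \<in> ?H" "b \<in> ?H" "x \<in> N" for a b x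
    using that assms(3)[of "- a" "- b" x] by simp
  then have "add_subgroup ?H"
    using assms(2,3) by (auto simp: add_subgroup_def)
  moreover have "S \<subseteq> ?H"
    using assms(5) by auto
  ultimately have "UNIV \<subseteq> ?H"
    unfolding assms(1)[symmetric] subgroup_generated_def by blast
  then show ?thesis
    using assms(4) by (auto simp: submodule_def)
qed

text \<open>Compactness of the generating set enters here: it makes the set of all
  \<open>act a v\<close> with \<open>a\<close> a generator and \<open>v\<close> in \<open>V\<close>
  compact, so that finitely many translates cover it.\<close>

lemma compact_submodule_neighbourhood:
  fixes act :: "'a::{topological_ab_group_add,t2_space} \<Rightarrow> 'm::{topological_ab_group_add,t2_space} \<Rightarrow> 'm"
  assumes "compactly_generated_group TYPE('a)" and "LC_module act"
  obtains U N where "open U" "0 \<in> U" "submodule act N" "compact N"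
    "U \<inter> closure (polycompact_radical act) \<subseteq> N"
proof -
  let ?W = "polycompact_radical act"
  let ?add = "\<lambda>(x, y). x + y"
  have act: "\<And>m. act 0 m = m" "\<And>a b m. act (a + b) m = act a (act b m)"
    and add: "\<And>a x y. act a (x + y) = act a x + act a y"
    and cont: "\<And>a. continuous_on UNIV (act a)" "continuous_on UNIV (\<lambda>(a, m). act a m)"
    and lc: "LCA_group TYPE('m)"
    using assms(2) by (auto simp: LC_module_def)
  have W: "submodule act ?W" "submodule act (closure ?W)"
    using submodule_polycompact_radical[of act, OF add] submodule_closure cont(1) by blast+
  obtain S0 :: "'a set" where S0: "compact S0" "subgroup_generated S0 = UNIV"
    using assms(1) by (auto simp: compactly_generated_group_def)
  \<comment> \<open>Symmetrised so that stability under \<open>S\<close> yields both signs for each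
    generator in \<open>S0\<close>.\<close>
  define S where "S = S0 \<union> uminus ` S0"
  have "compact S"
    unfolding S_def using S0(1) by (intro compact_Un compact_continuous_image continuous_intros)
  obtain U V0 :: "'m set" where UV0:
    "open U" "compact V0" "0 \<in> U" "U \<subseteq> V0" "uminus ` V0 \<subseteq> V0"
    using compact_symmetric_neighbourhood[OF lc] by metis
  \<comment> \<open>Cutting down to the closure keeps \<open>C\<close> below inside it, where
    centres from \<open>?W\<close> suffice. The closure is a submodule, so symmetry
    survives.\<close>
  define V where "V = V0 \<inter> closure ?W"
  have V: "compact V" "0 \<in> V" "U \<inter> closure ?W \<subseteq> V" "V \<subseteq> closure ?W"
    "\<And>x. x \<in> V \<Longrightarrow> - x \<in> V"
    using UV0 W(2) by (auto simp: V_def compact_Int_closed submodule_def add_subgroup_def)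
  \<comment> \<open>\<open>C\<close> collects everything that can leave \<open>V\<close> under a
    generator or under addition; negation already preserves \<open>V\<close>.\<close>
  define C where "C = (\<lambda>(a, m). act a m) ` (S \<times> V) \<union> ?add ` (V \<times> V)"
  have "compact C"
    unfolding C_def using \<open>compact S\<close> V(1) cont(2)
    by (intro compact_Un compact_plus compact_continuous_image compact_Times)
      (auto intro: continuous_on_subset)
  moreover have "C \<subseteq> closure ?W"
    using W(2) by (auto dest!: subsetD[OF V(4)] simp: C_def submodule_def add_subgroup_def)
  ultimately obtain F where F: "finite F" "F \<subseteq> ?W"
    "\<And>x. x \<in> C \<Longrightarrow> \<exists>w\<in>F. x - w \<in> U \<inter> closure ?W"
    using compact_subset_closure_finite_translates[of ?W U C] W(1) UV0
    by (auto simp: submodule_def)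
  obtain L where L: "submodule act L" "compact L" "F \<subseteq> L"
    using finite_subset_polycompact_radical[of act, OF add F(1,2)] by metis
  have Lsub: "0 \<in> L" "\<And>x y. x \<in> L \<Longrightarrow> y \<in> L \<Longrightarrow> x + y \<in> L" "\<And>x. x \<in> L \<Longrightarrow> - x \<in> L"
      "\<And>a x. x \<in> L \<Longrightarrow> act a x \<in> L"
    using L(1) by (auto simp: submodule_def add_subgroup_def)
  define N where "N = ?add ` (L \<times> V)"
  have NI: "l + v \<in> N" if "l \<in> L" "v \<in> V" for l v
    using that by (auto simp: N_def)
  \<comment> \<open>The centre \<open>w\<close> of a translate containing \<open>c\<close> is moved
    into \<open>L\<close>: \<open>l + c = (l + w) + (c - w)\<close>.\<close>
  have LC: "l + c \<in> N" if lc: "l \<in> L" "c \<in> C" for l c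
  proof -
    obtain w where "w \<in> F" "c - w \<in> V"
      using F(3) lc(2) V(3) by blast
    then have "(l + w) + (c - w) \<in> N"
      using L(3) lc(1) by (intro NI Lsub(2)) auto
    then show ?thesis by simp
  qed
  have "add_subgroup N"
  proof -
    have "(l + v) + (l' + v') \<in> N" if "l \<in> L" "v \<in> V" "l' \<in> L" "v' \<in> V" for l v l' v'
    proof -
      have "(l + l') + (v + v') \<in> N"
        using that by (intro LC Lsub(2)) (auto simp: C_def)
      then show ?thesis by (simp add: algebra_simps)
    qed
    moreover have "- (l + v) \<in> N" if "l \<in> L" "v \<in> V" for l v
      using NI[OF Lsub(3) V(5)] that by simp
    moreover have "0 \<in> N"
      using NI[OF Lsub(1) V(2)] by simp
    ultimately show ?thesis
      unfolding add_subgroup_def by (auto simp: N_def)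
  qed
  moreover have "act a x \<in> N" if ax: "a \<in> S" "x \<in> N" for a x
  proof -
    obtain l v where "l \<in> L" "v \<in> V" "x = l + v"
      using ax(2) by (auto simp: N_def)
    moreover from this have "act a v \<in> C"
      using ax(1) by (auto simp: C_def)
    ultimately show ?thesis
      using LC Lsub(4) by (simp add: add)
  qed
  ultimately have "submodule act N"
    using S0(2) act by (intro submodule_if_generators[of S0]) (auto simp: S_def)
  moreover have "compact N"
    unfolding N_def using L(2) V(1) by (rule compact_plus)
  moreover have "U \<inter> closure ?W \<subseteq> N"
    using NI[OF Lsub(1)] V(3) by auto
  ultimately show ?thesis
    using UV0 that by blast
qed

section \<open>Closedness of the radical and its compact subsets\<close>

theorem mainTheorem1:
  fixes act :: "'a::{topological_ab_group_add,t2_space} \<Rightarrow> 'm::{topological_ab_group_add,t2_space} \<Rightarrow> 'm"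
  assumes "LCA_group TYPE('a)"
    and "compactly_generated_group TYPE('a)"
    and "LC_module act"
  shows "add_subgroup (polycompact_radical act) \<and> closed (polycompact_radical act) \<and>
         (\<forall>K. compact K \<and> K \<subseteq> polycompact_radical act \<longrightarrow>
              (\<exists>N. submodule act N \<and> compact N \<and> K \<subseteq> N))"
proof -
  let ?W = "polycompact_radical act"
  have add: "\<And>a x y. act a (x + y) = act a x + act a y"
    using assms(3) by (auto simp: LC_module_def)
  have W: "add_subgroup ?W"
    using submodule_polycompact_radical[of act, OF add] by (simp add: submodule_def)
  obtain U N where N: "open U" "0 \<in> U" "submodule act N" "compact N" "U \<inter> closure ?W \<subseteq> N"
    using compact_submodule_neighbourhood[OF assms(2,3)] by metis
  \<comment> \<open>Allowing \<open>K\<close> in the closure serves both claims at once: singletons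
    give closedness, and compact subsets of \<open>?W\<close> are a special case.\<close>
  have main: "\<exists>N. submodule act N \<and> compact N \<and> K \<subseteq> N"
    if K: "compact K" "K \<subseteq> closure ?W" for K
  proof -
    obtain F where F: "finite F" "F \<subseteq> ?W"
      "\<And>x. x \<in> K \<Longrightarrow> \<exists>w\<in>F. x - w \<in> U \<inter> closure ?W"
      using compact_subset_closure_finite_translates[OF W N(1,2) K] by metis
    obtain L where L: "submodule act L" "compact L" "F \<subseteq> L"
      using finite_subset_polycompact_radical[of act, OF add F(1,2)] by metis
    \<comment> \<open>\<open>L\<close> contains the centres of the translates covering
      \<open>K\<close>, and \<open>N\<close> contains the differences.\<close>
    have "K \<subseteq> (\<lambda>(x, y). x + y) ` (L \<times> N)"
    proof
      fix x assume "x \<in> K"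
      then obtain w where "w \<in> L" "x - w \<in> N"
        using F(3) L(3) N(5) by blast
      then show "x \<in> (\<lambda>(x, y). x + y) ` (L \<times> N)"
        by (intro image_eqI[of _ _ "(w, x - w)"]) auto
    qed
    then show ?thesis
      using submodule_plus[of act L N, OF add L(1) N(3)] compact_plus[OF L(2) N(4)] by blast
  qed
  have "closure ?W \<subseteq> ?W"
  proof
    fix x assume "x \<in> closure ?W"
    then show "x \<in> ?W"
      using main[of "{x}"] by (auto simp: polycompact_radical_eq_Union[of act, OF add])
  qed
  then have "closed ?W"
    by (metis closure_subset closure_closed closed_closure subset_antisym)
  then show ?thesis
    using W main closure_subset by blast
qed

end
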